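(* Let $X$ be a normed space, $C\subset X$ a non-zero normal wedge and let $T:C\to C$ be positively homogeneous, additive and Lipschitz. If $t$ is a real number with $$\sup\{r_x(T):x\in C\}\le t\le r(T),$$ then $t\in\sigma_{ap}(T)$. In particular, $r(T)\in\sigma_{ap}(T)$. Moreover, $r(T)=\max\{t:t\in\sigma_{ap}(T)\}$.
   Context: Normed spaces are real and not assumed complete. A subset $C$ of $X$ is a cone if $sC\subset C$ for all $s\ge0$; a wedge is a convex cone (it is not assumed closed). A wedge $C$ induces a preorder: $x\le y$ iff $y-x\in C$. The wedge $C$ is normal if there is a constant $M$ such that $\|x\|\le M\|y\|$ whenever $x\le y$, $x,y\in C$. A map $T:C\to C$ is positively homogeneous if $T(sx)=sT(x)$ for all $s\ge0$, $x\in C$; additive if $T(x+y)=Tx+Ty$ for all $x,y\in C$; Lipschitz if there is $L>0$ with $\|Tx-Ty\|\le L\|x-y\|$ for all $x,y\in C$. A positively homogeneous map is bounded if $\|T\|:=\sup\{\|Tx\|/\|x\|:x\in C,\ x\ne0\}<\infty$ (positively homogeneous Lipschitz maps are bounded). The Bonsall cone spectral radius is $r(T)=\lim_{n\to\infty}\|T^n\|^{1/n}=\inf_n\|T^n\|^{1/n}$ (the limit exists), where $\|T^n\|$ is defined by the same formula as $\|T\|$. The local cone spectral radius at $x\in C$ is $r_x(T)=\limsup_{n\to\infty}\|T^nx\|^{1/n}$. The approximate point spectrum $\sigma_{ap}(T)$ is the set of all $s\ge0$ such that $\inf\{\|Tx-sx\|:x\in C,\ \|x\|=1\}=0$. *)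

theory Defs
  imports "HOL-Analysis.Analysis"
begin

text \<open>A wedge is a \<^const>\<open>convex_cone\<close>. A self-map of a wedge \<open>C\<close> is represented by a
  total function \<open>T\<close> with \<open>T ` C \<subseteq> C\<close>; every definition below depends only on
  the values of \<open>T\<close> on \<open>C\<close>.\<close>

definition wedge_le :: "'a::real_vector set \<Rightarrow> 'a \<Rightarrow> 'a \<Rightarrow> bool" where
  "wedge_le C x y \<longleftrightarrow> y - x \<in> C"

definition normal_wedge :: "'a::real_normed_vector set \<Rightarrow> bool" where
  "normal_wedge C \<longleftrightarrow> (\<exists>M. \<forall>x\<in>C. \<forall>y\<in>C. wedge_le C x y \<longrightarrow> norm x \<le> M * norm y)"

definition positively_homogeneous_on ::
    "'a::real_vector set \<Rightarrow> ('a \<Rightarrow> 'a) \<Rightarrow> bool" where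
  "positively_homogeneous_on C T \<longleftrightarrow> (\<forall>s\<ge>0. \<forall>x\<in>C. T (s *\<^sub>R x) = s *\<^sub>R T x)"

definition additive_on :: "'a::real_vector set \<Rightarrow> ('a \<Rightarrow> 'a) \<Rightarrow> bool" where
  "additive_on C T \<longleftrightarrow> (\<forall>x\<in>C. \<forall>y\<in>C. T (x + y) = T x + T y)"

text \<open>The supremum is taken in the reals, hence is meaningful only if \<open>T\<close> is bounded on \<open>C\<close>
  and \<open>C\<close> contains a non-zero vector; both hold for a positively homogeneous Lipschitz map on a
  non-zero wedge, and then also for all iterates of \<open>T\<close>.\<close>

definition cone_norm :: "'a::real_normed_vector set \<Rightarrow> ('a \<Rightarrow> 'a) \<Rightarrow> real" where
  "cone_norm C T = (SUP x\<in>C - {0}. norm (T x) / norm x)"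

text \<open>The value \<open>root 0 _ = 0\<close> at \<open>n = 0\<close> does not affect the limits below.\<close>

definition bonsall_radius :: "'a::real_normed_vector set \<Rightarrow> ('a \<Rightarrow> 'a) \<Rightarrow> real" where
  "bonsall_radius C T = lim (\<lambda>n. root n (cone_norm C (T ^^ n)))"

text \<open>Extended reals make the upper limit, and suprema of it over \<open>C\<close>, unconditionally
  meaningful.\<close>

definition local_radius :: "('a::real_normed_vector \<Rightarrow> 'a) \<Rightarrow> 'a \<Rightarrow> ereal" where
  "local_radius T x = limsup (\<lambda>n. ereal (root n (norm ((T ^^ n) x))))"

definition approx_point_spectrum ::
    "'a::real_normed_vector set \<Rightarrow> ('a \<Rightarrow> 'a) \<Rightarrow> real set" where
  "approx_point_spectrum C T =
     {s. 0 \<le> s \<and> (INF x\<in>{x \<in> C. norm x = 1}. norm (T x - s *\<^sub>R x)) = 0}"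

end

theory Submission
  imports Defs
begin

text \<open>The argument is a resolvent estimate in which positivity replaces invertibility. Let \<open>t\<close>
  bound all local radii and suppose that \<open>t\<close> is not in the approximate point spectrum. Then
  \<open>t - T\<close> is bounded below on the wedge, and so is \<open>s - T\<close> for \<open>s > t\<close> near \<open>t\<close>, with almost the
  same constant. For such \<open>s\<close> the vectors \<open>(T / s)\<^sup>n x\<close> tend to zero, so \<open>s - T\<close> maps the
  partial sums of the Neumann series \<open>\<Sum>n. (T / s)\<^sup>n x\<close>, which lie in the wedge, to vectors close
  to \<open>s x\<close>. The sums of high index are therefore bounded by a multiple of the norm of \<open>x\<close>, and
  by normality those of low index are too (\<open>neumann_bound\<close>). The bound is uniform in \<open>s\<close> and in
  the number of terms.

  Letting \<open>s\<close> decrease to \<open>t\<close> first forces \<open>t > 0\<close> and then bounds the operators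
  \<open>S = \<Sum>n<N. (T / t)\<^sup>n\<close> independently of \<open>N\<close>. The square of \<open>S\<close> dominates \<open>N (T / t)\<^sup>N\<^sup>-\<^sup>1\<close> in
  the wedge order, so by normality the powers of \<open>T / t\<close> tend to zero in norm
  (\<open>decay_if_bounded_below\<close>). One power of norm less than 1 gives \<open>r(T) < t\<close>. Hence every \<open>t\<close>
  between the local radii and \<open>r(T)\<close> is in the approximate point spectrum; \<open>r(T)\<close> itself is such
  a \<open>t\<close>, since no local radius exceeds it.

  Conversely, a Lipschitz map turns approximate eigenvectors for \<open>t\<close> into approximate
  eigenvectors of \<open>T\<^sup>n\<close> for \<open>t\<^sup>n\<close>, so \<open>t\<^sup>n\<close> is at most the norm of \<open>T\<^sup>n\<close>, and no element of the
  spectrum exceeds \<open>r(T)\<close> (\<open>spectrum_le_bonsall_radius\<close>).\<close>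

section \<open>Submultiplicative sequences\<close>

lemma submultiplicative_le_geometric:
  fixes a :: "nat \<Rightarrow> real"
  assumes nonneg: "\<And>n. 0 \<le> a n" and submult: "\<And>m n. a (m + n) \<le> a m * a n"
    and "0 < m" "0 < c" and am: "a m \<le> c ^ m"
  obtains B where "0 < B" "\<And>n. a n \<le> B * c ^ n"
proof
  \<comment> \<open>The sum handles the remainders modulo \<open>m\<close>; the summand 1 makes \<open>B\<close> positive.\<close>
  define B where "B = 1 + (\<Sum>p<m. a p / c ^ p)"
  have "0 \<le> (\<Sum>p<m. a p / c ^ p)"
    by (intro sum_nonneg divide_nonneg_nonneg) (use nonneg \<open>0 < c\<close> in auto)
  then show "0 < B"
    by (simp add: B_def)
  show "a n \<le> B * c ^ n" for n
  proof (induction n rule: less_induct)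
    case (less n)
    show ?case
    proof (cases "n < m")
      case True
      have "a n / c ^ n \<le> (\<Sum>p<m. a p / c ^ p)"
        by (rule member_le_sum) (use True nonneg \<open>0 < c\<close> in auto)
      then have "a n / c ^ n \<le> B"
        by (simp add: B_def)
      then show ?thesis
        using \<open>0 < c\<close> by (simp add: divide_le_eq)
    next
      case False
      then have n: "n = m + (n - m)" by simp
      have "a n \<le> a m * a (n - m)"
        using submult[of m "n - m"] n by simp
      also have "\<dots> \<le> c ^ m * (B * c ^ (n - m))"
        by (intro mult_mono am less.IH) (use False \<open>0 < m\<close> \<open>0 < c\<close> nonneg in auto)
      also have "\<dots> = B * c ^ n"
        by (subst (2) n) (simp only: power_add mult_ac)
      finally show ?thesis .
    qed
  qed
qed

text \<open>Fekete's lemma in multiplicative form. Working with powers instead of logarithms admits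
  sequences that vanish from some index on, as the norms of the powers of a nilpotent map do.\<close>

lemma submultiplicative_root_tendsto:
  fixes a :: "nat \<Rightarrow> real"
  assumes nonneg: "\<And>n. 0 \<le> a n" and submult: "\<And>m n. a (m + n) \<le> a m * a n"
  obtains r where "(\<lambda>n. root n (a n)) \<longlonglongrightarrow> r" "\<And>m. 0 < m \<Longrightarrow> r \<le> root m (a m)" "0 \<le> r"
proof
  define r where "r = (INF m\<in>{0<..}. root m (a m))"
  have bdd: "bdd_below ((\<lambda>m. root m (a m)) ` {0<..})"
    by (intro bdd_belowI2[where m = 0]) (use nonneg in auto)
  show lower: "r \<le> root m (a m)" if "0 < m" for m
    unfolding r_def by (rule cINF_lower[OF bdd]) (use that in auto)
  show "0 \<le> r"
    unfolding r_def by (rule cINF_greatest) (use nonneg in auto)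
  show "(\<lambda>n. root n (a n)) \<longlonglongrightarrow> r"
  proof (rule order_tendstoI)
    fix y assume "y < r"
    show "\<forall>\<^sub>F n in sequentially. y < root n (a n)"
      using eventually_gt_at_top[of 0]
      by eventually_elim (use lower \<open>y < r\<close> in \<open>auto intro: less_le_trans\<close>)
  next
    fix y assume "r < y"
    then obtain m where m: "0 < m" "root m (a m) < y"
      using cINF_less_iff[OF _ bdd, of y] by (auto simp: r_def)
    define c where "c = (root m (a m) + y) / 2"
    have c: "root m (a m) < c" "c < y"
      using m by (auto simp: c_def)
    have root_nonneg: "0 \<le> root m (a m)"
      using nonneg by (rule real_root_ge_zero)
    then have "0 < c"
      using c by linarith
    have "root m (a m) ^ m \<le> c ^ m"
      by (rule power_mono) (use c root_nonneg in auto)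
    then have "a m \<le> c ^ m"
      using m nonneg by simp
    then obtain B where B: "0 < B" "\<And>n. a n \<le> B * c ^ n"
      using submultiplicative_le_geometric[OF nonneg submult m(1) \<open>0 < c\<close>] by blast
    have "(\<lambda>n. root n B * c) \<longlonglongrightarrow> 1 * c"
      by (intro tendsto_mult LIMSEQ_root_const tendsto_const B)
    then have "\<forall>\<^sub>F n in sequentially. root n B * c < y"
      using c by (auto dest: order_tendstoD(2))
    then show "\<forall>\<^sub>F n in sequentially. root n (a n) < y"
      using eventually_gt_at_top[of 0]
    proof eventually_elim
      case (elim n)
      have "root n (a n) \<le> root n (B * c ^ n)"
        using elim B by simp
      also have "\<dots> = root n B * c"
        using elim \<open>0 < c\<close> by (simp add: real_root_mult real_root_power_cancel)
      finally show ?case using elim by linarith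
    qed
  qed
qed

section \<open>Additive homogeneous maps of a wedge\<close>

locale wedge_map =
  fixes C :: "'a::real_normed_vector set" and T :: "'a \<Rightarrow> 'a"
  assumes wedge: "convex_cone C"
    and maps: "x \<in> C \<Longrightarrow> T x \<in> C"
    and hom: "0 \<le> c \<Longrightarrow> x \<in> C \<Longrightarrow> T (c *\<^sub>R x) = c *\<^sub>R T x"
    and add: "x \<in> C \<Longrightarrow> y \<in> C \<Longrightarrow> T (x + y) = T x + T y"
begin

lemma sum_in_wedge: "(\<And>i. i \<in> I \<Longrightarrow> f i \<in> C) \<Longrightarrow> sum f I \<in> C"
  by (induction I rule: infinite_finite_induct)
     (auto intro: convex_cone_add[OF wedge] convex_cone_contains_0[OF wedge])

lemma iterate_maps: "x \<in> C \<Longrightarrow> (T ^^ n) x \<in> C"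
  by (induction n) (auto intro: maps)

lemma iterate_hom: "0 \<le> c \<Longrightarrow> x \<in> C \<Longrightarrow> (T ^^ n) (c *\<^sub>R x) = c *\<^sub>R (T ^^ n) x"
  by (induction n) (auto simp: hom iterate_maps)

lemma iterate_add: "x \<in> C \<Longrightarrow> y \<in> C \<Longrightarrow> (T ^^ n) (x + y) = (T ^^ n) x + (T ^^ n) y"
  by (induction n) (auto simp: add iterate_maps)

text \<open>Up to the factor \<open>s\<close>, the partial sums of the Neumann series of \<open>(s - T)\<inverse>\<close>.\<close>

definition neumann :: "real \<Rightarrow> nat \<Rightarrow> 'a \<Rightarrow> 'a" where
  "neumann s N x = (\<Sum>n<N. (1 / s ^ n) *\<^sub>R (T ^^ n) x)"

lemma neumann_term_in_wedge: "0 < s \<Longrightarrow> x \<in> C \<Longrightarrow> (1 / s ^ n) *\<^sub>R (T ^^ n) x \<in> C"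
  by (intro convex_cone_scaleR[OF wedge] iterate_maps) auto

lemma neumann_in_wedge: "0 < s \<Longrightarrow> x \<in> C \<Longrightarrow> neumann s N x \<in> C"
  unfolding neumann_def by (intro sum_in_wedge neumann_term_in_wedge)

lemma neumann_telescope:
  assumes "0 < s" "x \<in> C"
  shows "s *\<^sub>R neumann s N x - T (neumann s N x) = s *\<^sub>R (x - (1 / s ^ N) *\<^sub>R (T ^^ N) x)"
proof (induction N)
  case 0
  have "T 0 = 0"
    using hom[of 0 x] assms by simp
  then show ?case
    by (simp add: neumann_def)
next
  case (Suc N)
  let ?u = "(1 / s ^ N) *\<^sub>R (T ^^ N) x"
  have "T (neumann s N x + ?u) = T (neumann s N x) + T ?u"
    by (intro add neumann_in_wedge neumann_term_in_wedge assms)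
  moreover have "T ?u = (1 / s ^ N) *\<^sub>R (T ^^ Suc N) x"
    using hom[of "1 / s ^ N" "(T ^^ N) x"] assms by (simp add: iterate_maps)
  moreover have "(1 / s ^ N) *\<^sub>R (T ^^ Suc N) x = s *\<^sub>R (1 / s ^ Suc N) *\<^sub>R (T ^^ Suc N) x"
    using assms by simp
  moreover have "neumann s (Suc N) x = neumann s N x + ?u"
    by (simp add: neumann_def)
  ultimately show ?case
    using Suc.IH assms by (simp add: algebra_simps)
qed

lemma neumann_minus_term_in_wedge:
  assumes "0 < s" "x \<in> C" "n < N"
  shows "neumann s N x - (1 / s ^ n) *\<^sub>R (T ^^ n) x \<in> C"
proof -
  have "neumann s N x - (1 / s ^ n) *\<^sub>R (T ^^ n) x
      = (\<Sum>i\<in>{..<N} - {n}. (1 / s ^ i) *\<^sub>R (T ^^ i) x)"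
    using assms by (simp add: neumann_def sum_diff1)
  then show ?thesis
    using assms by (auto intro!: sum_in_wedge neumann_term_in_wedge)
qed

lemma neumann_mono_in_wedge:
  assumes "0 < s" "x \<in> C" "N \<le> N'"
  shows "neumann s N' x - neumann s N x \<in> C"
proof -
  have "neumann s N' x - neumann s N x = (\<Sum>i\<in>{..<N'} - {..<N}. (1 / s ^ i) *\<^sub>R (T ^^ i) x)"
    unfolding neumann_def by (rule sum_diff[symmetric]) (use assms in auto)
  then show ?thesis
    using assms by (auto intro!: sum_in_wedge neumann_term_in_wedge)
qed

text \<open>In the formal square of \<open>\<Sum>n\<le>k. (T / s) ^ n\<close> the power of index \<open>k\<close> arises from
  \<open>k + 1\<close> pairs of indices, and the remaining terms map the wedge into itself.\<close>

lemma neumann_square_minus_in_wedge: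
  assumes "0 < s" "x \<in> C"
  shows "neumann s (Suc k) (neumann s (Suc k) x) - real (Suc k) *\<^sub>R (1 / s ^ k) *\<^sub>R (T ^^ k) x \<in> C"
proof -
  let ?y = "neumann s (Suc k) x"
  let ?u = "\<lambda>i. (1 / s ^ i) *\<^sub>R (T ^^ i) x"
  have split: "(1 / s ^ i) *\<^sub>R (T ^^ i) ?y - ?u k
      = (1 / s ^ i) *\<^sub>R (T ^^ i) (?y - ?u (k - i))" if "i < Suc k" for i
  proof -
    have u: "?u (k - i) \<in> C" and d: "?y - ?u (k - i) \<in> C"
      using assms that by (auto intro: neumann_term_in_wedge neumann_minus_term_in_wedge)
    have "(T ^^ i) ?y = (T ^^ i) (?y - ?u (k - i)) + (T ^^ i) (?u (k - i))"
      using iterate_add[OF d u, of i] by simp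
    moreover have "(T ^^ i) (?u (k - i)) = (1 / s ^ (k - i)) *\<^sub>R (T ^^ k) x"
      using iterate_hom[of "1 / s ^ (k - i)" "(T ^^ (k - i)) x" i] assms that
      by (simp add: iterate_maps funpow_add[symmetric, THEN fun_cong, unfolded o_def])
    moreover have "(1 / s ^ i) * (1 / s ^ (k - i)) = 1 / s ^ k"
      using that by (simp add: power_add[symmetric])
    ultimately show ?thesis
      by (simp add: scaleR_add_right)
  qed
  have "neumann s (Suc k) ?y - real (Suc k) *\<^sub>R ?u k
      = (\<Sum>i<Suc k. (1 / s ^ i) *\<^sub>R (T ^^ i) ?y - ?u k)"
    by (simp only: neumann_def[of s "Suc k" ?y] sum_subtractf sum_constant_scaleR card_lessThan)
  also have "\<dots> = (\<Sum>i<Suc k. (1 / s ^ i) *\<^sub>R (T ^^ i) (?y - ?u (k - i)))"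
    by (intro sum.cong refl split) auto
  also have "\<dots> \<in> C"
    using assms by (intro sum_in_wedge neumann_term_in_wedge neumann_minus_term_in_wedge) auto
  finally show ?thesis .
qed

section \<open>A quantitative resolvent estimate\<close>

text \<open>By the telescoping identity, \<open>s - T\<close> maps the partial sum of index \<open>N'\<close> to
  \<open>s *\<^sub>R (x - (T / s) ^ N' x)\<close>, whose norm tends to \<open>s * norm x\<close>. Since \<open>s\<close> is closer to \<open>t\<close>
  than \<open>\<delta>\<close>, the operator \<open>s - T\<close> is still bounded below, by \<open>\<delta> - (s - t)\<close>. Normality
  transfers the resulting bound from the limit \<open>N' \<rightarrow> \<infinity>\<close> to every smaller partial sum, so that
  no limit of the sums is needed in the possibly incomplete space.\<close>

lemma neumann_bound:
  assumes normal: "\<And>x y. x \<in> C \<Longrightarrow> y \<in> C \<Longrightarrow> y - x \<in> C \<Longrightarrow> norm x \<le> M * norm y" and "0 \<le> M"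
    and below: "\<And>x. x \<in> C \<Longrightarrow> \<delta> * norm x \<le> norm (T x - t *\<^sub>R x)"
    and s: "0 \<le> t" "t < s" "s < t + \<delta>"
    and x: "x \<in> C" and lim: "(\<lambda>n. (1 / s ^ n) *\<^sub>R (T ^^ n) x) \<longlonglongrightarrow> 0"
  shows "(\<delta> - (s - t)) * norm (neumann s N x) \<le> M * s * norm x"
proof -
  have "0 < s" using s by simp
  have below_s: "(\<delta> - (s - t)) * norm y \<le> norm (s *\<^sub>R y - T y)" if "y \<in> C" for y
  proof -
    have "norm (T y - t *\<^sub>R y) \<le> norm (T y - s *\<^sub>R y) + norm ((s - t) *\<^sub>R y)"
      by (rule order_trans[OF _ norm_triangle_ineq]) (simp add: algebra_simps)
    also have "norm ((s - t) *\<^sub>R y) = (s - t) * norm y"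
      using s by simp
    finally show ?thesis
      using below[OF that] by (simp add: left_diff_distrib norm_minus_commute[of "T y"])
  qed
  have "(\<lambda>n. M * norm (s *\<^sub>R (x - (1 / s ^ n) *\<^sub>R (T ^^ n) x))) \<longlonglongrightarrow> M * norm (s *\<^sub>R (x - 0))"
    by (intro tendsto_intros lim)
  moreover have "\<forall>\<^sub>F n in sequentially. (\<delta> - (s - t)) * norm (neumann s N x)
      \<le> M * norm (s *\<^sub>R (x - (1 / s ^ n) *\<^sub>R (T ^^ n) x))"
    using eventually_ge_at_top[of N]
  proof eventually_elim
    case (elim n)
    have "norm (neumann s N x) \<le> M * norm (neumann s n x)"
      using \<open>0 < s\<close> x elim by (intro normal neumann_in_wedge neumann_mono_in_wedge)
    then have "(\<delta> - (s - t)) * norm (neumann s N x)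
        \<le> (\<delta> - (s - t)) * (M * norm (neumann s n x))"
      using s by (intro mult_left_mono) auto
    also have "\<dots> = M * ((\<delta> - (s - t)) * norm (neumann s n x))"
      by simp
    also have "\<dots> \<le> M * norm (s *\<^sub>R neumann s n x - T (neumann s n x))"
      by (intro mult_left_mono below_s neumann_in_wedge \<open>0 < s\<close> x \<open>0 \<le> M\<close>)
    finally show ?case
      by (simp only: neumann_telescope[OF \<open>0 < s\<close> x])
  qed
  ultimately have "(\<delta> - (s - t)) * norm (neumann s N x) \<le> M * norm (s *\<^sub>R (x - 0))"
    by (intro tendsto_lowerbound) auto
  then show ?thesis
    using \<open>0 < s\<close> by simp
qed

text \<open>Both sides of the preceding estimate are continuous in \<open>s\<close> at \<open>t > 0\<close>, so it persists at
  \<open>s = t\<close>. There the powers of \<open>T / t\<close> have bounded partial sums, and comparing the square of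
  a partial sum with its middle term forces these powers to zero, at the rate \<open>1 / n\<close>.\<close>

lemma decay_if_bounded_below:
  assumes normal: "\<And>x y. x \<in> C \<Longrightarrow> y \<in> C \<Longrightarrow> y - x \<in> C \<Longrightarrow> norm x \<le> M * norm y" and "0 \<le> M"
    and "0 < \<delta>" and below: "\<And>x. x \<in> C \<Longrightarrow> \<delta> * norm x \<le> norm (T x - t *\<^sub>R x)"
    and "0 \<le> t"
    and lim: "\<And>s x. t < s \<Longrightarrow> x \<in> C \<Longrightarrow> (\<lambda>n. (1 / s ^ n) *\<^sub>R (T ^^ n) x) \<longlonglongrightarrow> 0"
    and nontrivial: "x\<^sub>0 \<in> C" "x\<^sub>0 \<noteq> 0"
  obtains n where "0 < n" "0 < t" "\<And>x. x \<in> C \<Longrightarrow> norm ((T ^^ n) x) \<le> (1 / 2) * t ^ n * norm x"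
proof -
  have ev: "\<forall>\<^sub>F s in at_right t. (\<delta> - (s - t)) * norm (neumann s N x) \<le> M * s * norm x"
    if "x \<in> C" for x N
  proof -
    have "\<forall>\<^sub>F s in at_right t. s \<in> {t<..<t + \<delta>}"
      by (rule eventually_at_rightI[of _ "t + \<delta>"]) (use \<open>0 < \<delta>\<close> in auto)
    then show ?thesis
      by eventually_elim (use that lim \<open>0 \<le> t\<close> in
          \<open>auto intro!: neumann_bound[OF normal \<open>0 \<le> M\<close> below]\<close>)
  qed
  \<comment> \<open>Continuity is a premise so that the case \<open>N = 1\<close> covers \<open>t = 0\<close>; for larger \<open>N\<close> the
    terms \<open>T\<^sup>n x / s\<^sup>n\<close> can blow up as \<open>s\<close> tends to 0.\<close>
  have bound: "\<delta> * norm (neumann t N x) \<le> M * t * norm x"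
    if "x \<in> C" and cont: "((\<lambda>s. neumann s N x) \<longlongrightarrow> neumann t N x) (at_right t)" for x N
  proof -
    have "((\<lambda>s. (\<delta> - (s - t)) * norm (neumann s N x)) \<longlongrightarrow> (\<delta> - (t - t)) * norm (neumann t N x))
        (at_right t)"
      by (intro tendsto_intros cont)
    moreover have "((\<lambda>s. M * s * norm x) \<longlongrightarrow> M * t * norm x) (at_right t)"
      by (intro tendsto_intros)
    ultimately have "(\<delta> - (t - t)) * norm (neumann t N x) \<le> M * t * norm x"
      using ev[OF that(1), of N] by (intro tendsto_le[of "at_right t"]) auto
    then show ?thesis by simp
  qed
  \<comment> \<open>The partial sum of index 1 is \<open>x\<close> itself, which excludes \<open>t = 0\<close>.\<close>
  have "\<delta> * norm x\<^sub>0 \<le> M * t * norm x\<^sub>0"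
    using bound[OF nontrivial(1), of 1] by (simp add: neumann_def)
  then have "0 < t"
    using nontrivial \<open>0 < \<delta>\<close> \<open>0 \<le> t\<close> by (cases "t = 0") (auto simp: mult_le_0_iff)
  define K where "K = M * t / \<delta>"
  have "0 \<le> K"
    using \<open>0 \<le> M\<close> \<open>0 < t\<close> \<open>0 < \<delta>\<close> by (simp add: K_def)
  have K: "norm (neumann t N x) \<le> K * norm x" if "x \<in> C" for N x
  proof -
    have "((\<lambda>s. neumann s N x) \<longlongrightarrow> neumann t N x) (at_right t)"
      unfolding neumann_def using \<open>0 < t\<close> by (intro tendsto_intros) auto
    then show ?thesis
      using bound[OF that] \<open>0 < \<delta>\<close> by (simp add: K_def field_simps)
  qed
  have decay: "real (Suc k) * norm ((T ^^ k) x) \<le> M * K\<^sup>2 * t ^ k * norm x" if "x \<in> C" for k x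
  proof -
    let ?z = "neumann t (Suc k) (neumann t (Suc k) x)"
    let ?u = "real (Suc k) *\<^sub>R (1 / t ^ k) *\<^sub>R (T ^^ k) x"
    have "norm ?u \<le> M * norm ?z"
      using \<open>0 < t\<close> that
      by (intro normal neumann_square_minus_in_wedge neumann_in_wedge
          convex_cone_scaleR[OF wedge] neumann_term_in_wedge) auto
    also have "\<dots> \<le> M * (K * (K * norm x))"
      using \<open>0 < t\<close> that \<open>0 \<le> K\<close> \<open>0 \<le> M\<close>
      by (intro mult_left_mono order_trans[OF K] K neumann_in_wedge) auto
    finally have "real (Suc k) * norm ((T ^^ k) x) / t ^ k \<le> M * K\<^sup>2 * norm x"
      using \<open>0 < t\<close> by (simp add: power2_eq_square mult_ac del: of_nat_Suc)
    then show ?thesis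
      using \<open>0 < t\<close> by (simp add: field_simps del: of_nat_Suc)
  qed
  obtain k where k: "2 * (M * K\<^sup>2) < real k"
    using reals_Archimedean2 by blast
  show ?thesis
  proof
    show "0 < k"
      using k \<open>0 \<le> M\<close> by (cases k) (auto simp: not_less[symmetric] mult_less_0_iff)
    show "0 < t" by fact
    show "norm ((T ^^ k) x) \<le> (1 / 2) * t ^ k * norm x" if "x \<in> C" for x
    proof -
      have "real (Suc k) * norm ((T ^^ k) x) \<le> (M * K\<^sup>2) * (t ^ k * norm x)"
        using decay[OF that, of k] by (simp add: mult_ac)
      also have "\<dots> \<le> (real (Suc k) / 2) * (t ^ k * norm x)"
        using k \<open>0 < t\<close> by (intro mult_right_mono) auto
      also have "\<dots> = real (Suc k) * ((1 / 2) * t ^ k * norm x)"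
        by simp
      finally show ?thesis
        by (simp del: of_nat_Suc)
    qed
  qed
qed

end

section \<open>Cone norm and approximate point spectrum\<close>

lemma norm_le_cone_norm:
  assumes "\<And>x. x \<in> C \<Longrightarrow> norm (S x) \<le> c * norm x" and "x \<in> C"
  shows "norm (S x) \<le> cone_norm C S * norm x"
proof (cases "x = 0")
  case True
  then show ?thesis using assms(1)[OF assms(2)] by simp
next
  case False
  have "bdd_above ((\<lambda>x. norm (S x) / norm x) ` (C - {0}))"
    by (rule bdd_aboveI2[where M = c]) (use assms(1) in \<open>auto simp: divide_le_eq\<close>)
  then have "norm (S x) / norm x \<le> cone_norm C S"
    unfolding cone_norm_def by (rule cSUP_upper2) (use False assms(2) in auto)
  then show ?thesis
    using False by (simp add: divide_le_eq)
qed

lemma cone_norm_le: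
  assumes "\<And>x. x \<in> C \<Longrightarrow> norm (S x) \<le> c * norm x" and "x\<^sub>0 \<in> C" "x\<^sub>0 \<noteq> 0"
  shows "cone_norm C S \<le> c"
  unfolding cone_norm_def by (rule cSUP_least) (use assms in \<open>auto simp: divide_le_eq\<close>)

lemma approx_point_spectrum_iff:
  assumes "x\<^sub>0 \<in> C" "x\<^sub>0 \<noteq> 0" "convex_cone C"
  shows "s \<in> approx_point_spectrum C T \<longleftrightarrow>
    0 \<le> s \<and> (\<forall>\<epsilon>>0. \<exists>x\<in>C. norm x = 1 \<and> norm (T x - s *\<^sub>R x) < \<epsilon>)"
proof -
  let ?U = "{x \<in> C. norm x = 1}" and ?f = "\<lambda>x. norm (T x - s *\<^sub>R x)"
  have "(1 / norm x\<^sub>0) *\<^sub>R x\<^sub>0 \<in> C"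
    by (rule convex_cone_scaleR) (use assms in auto)
  then have "(1 / norm x\<^sub>0) *\<^sub>R x\<^sub>0 \<in> ?U"
    using assms by simp
  then have ne: "?U \<noteq> {}" by blast
  have bdd: "bdd_below (?f ` ?U)"
    by (rule bdd_belowI2[where m = 0]) simp
  have "0 \<le> (INF x\<in>?U. ?f x)"
    by (rule cINF_greatest[OF ne]) simp
  then have "(INF x\<in>?U. ?f x) = 0 \<longleftrightarrow> (\<forall>\<epsilon>>0. (INF x\<in>?U. ?f x) < \<epsilon>)"
    by (auto simp: order_less_le)
  also have "\<dots> \<longleftrightarrow> (\<forall>\<epsilon>>0. \<exists>x\<in>C. norm x = 1 \<and> ?f x < \<epsilon>)"
    using cINF_less_iff[OF ne bdd] by auto
  finally show ?thesis
    by (simp add: approx_point_spectrum_def)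
qed

text \<open>By homogeneity, a positive lower bound for \<open>norm (T x - s *\<^sub>R x)\<close> on the unit vectors of
  the wedge extends to all of it.\<close>

lemma (in wedge_map) bounded_below_if_not_in_spectrum:
  assumes "x\<^sub>0 \<in> C" "x\<^sub>0 \<noteq> 0" "0 \<le> s" "s \<notin> approx_point_spectrum C T"
  obtains \<delta> where "0 < \<delta>" "\<And>x. x \<in> C \<Longrightarrow> \<delta> * norm x \<le> norm (T x - s *\<^sub>R x)"
proof -
  obtain \<delta> where "0 < \<delta>" and \<delta>: "\<And>x. x \<in> C \<Longrightarrow> norm x = 1 \<Longrightarrow> \<delta> \<le> norm (T x - s *\<^sub>R x)"
    using assms approx_point_spectrum_iff[OF assms(1,2) wedge, of s T] by (auto simp: not_less)
  show thesis
  proof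
    show "0 < \<delta>" by fact
    show "\<delta> * norm x \<le> norm (T x - s *\<^sub>R x)" if "x \<in> C" for x
    proof (cases "x = 0")
      case True
      then show ?thesis by simp
    next
      case False
      let ?c = "1 / norm x"
      have "?c *\<^sub>R x \<in> C"
        by (rule convex_cone_scaleR[OF wedge _ that]) simp
      then have "\<delta> \<le> norm (T (?c *\<^sub>R x) - s *\<^sub>R ?c *\<^sub>R x)"
        by (rule \<delta>) (use False in simp)
      also have "T (?c *\<^sub>R x) - s *\<^sub>R ?c *\<^sub>R x = ?c *\<^sub>R (T x - s *\<^sub>R x)"
        using hom[of ?c x] that by (simp add: scaleR_diff_right)
      also have "norm \<dots> = norm (T x - s *\<^sub>R x) / norm x"
        by simp
      finally show ?thesis
        using False by (simp add: le_divide_eq)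
    qed
  qed
qed

section \<open>Spectral radii of Lipschitz maps\<close>

locale lipschitz_wedge_map = wedge_map +
  fixes L :: real and x\<^sub>0 :: 'a
  assumes lipschitz: "L-lipschitz_on C T"
    and nontrivial: "x\<^sub>0 \<in> C" "x\<^sub>0 \<noteq> 0"
begin

lemma norm_diff_le: "x \<in> C \<Longrightarrow> y \<in> C \<Longrightarrow> norm (T x - T y) \<le> L * norm (x - y)"
  using lipschitz_onD[OF lipschitz] by (simp add: dist_norm)

lemma L_nonneg: "0 \<le> L"
  using lipschitz by (rule lipschitz_on_nonneg)

lemma norm_iterate_le_power: "x \<in> C \<Longrightarrow> norm ((T ^^ n) x) \<le> L ^ n * norm x"
proof (induction n)
  case (Suc n)
  have "T 0 = 0"
    using hom[of 0 x] Suc.prems by simp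
  then have "norm (T ((T ^^ n) x)) \<le> L * norm ((T ^^ n) x)"
    using norm_diff_le[OF iterate_maps[OF Suc.prems] convex_cone_contains_0[OF wedge]] by simp
  also have "\<dots> \<le> L * (L ^ n * norm x)"
    by (intro mult_left_mono Suc L_nonneg)
  finally show ?case by simp
qed simp

lemma norm_iterate_le: "x \<in> C \<Longrightarrow> norm ((T ^^ n) x) \<le> cone_norm C (T ^^ n) * norm x"
  by (rule norm_le_cone_norm[OF norm_iterate_le_power])

lemma cone_norm_nonneg: "0 \<le> cone_norm C (T ^^ n)"
proof -
  have "0 \<le> cone_norm C (T ^^ n) * norm x\<^sub>0"
    by (rule order_trans[OF norm_ge_zero norm_iterate_le[OF nontrivial(1)]])
  then show ?thesis
    using nontrivial by (simp add: zero_le_mult_iff)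
qed

lemma cone_norm_submult: "cone_norm C (T ^^ (m + n)) \<le> cone_norm C (T ^^ m) * cone_norm C (T ^^ n)"
proof (rule cone_norm_le[OF _ nontrivial])
  fix x assume x: "x \<in> C"
  have "norm ((T ^^ (m + n)) x) \<le> cone_norm C (T ^^ m) * norm ((T ^^ n) x)"
    using norm_iterate_le[OF iterate_maps[OF x]] by (simp add: funpow_add)
  also have "\<dots> \<le> cone_norm C (T ^^ m) * (cone_norm C (T ^^ n) * norm x)"
    by (intro mult_left_mono norm_iterate_le x cone_norm_nonneg)
  finally show "norm ((T ^^ (m + n)) x) \<le> cone_norm C (T ^^ m) * cone_norm C (T ^^ n) * norm x"
    by (simp add: mult_ac)
qed

text \<open>The limit defining the Bonsall radius exists, so it has the properties of the limit in
  Fekete's lemma.\<close>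

lemma
  shows bonsall_radius_tendsto: "(\<lambda>n. root n (cone_norm C (T ^^ n))) \<longlonglongrightarrow> bonsall_radius C T"
    and bonsall_radius_le_root: "0 < m \<Longrightarrow> bonsall_radius C T \<le> root m (cone_norm C (T ^^ m))"
    and bonsall_radius_nonneg: "0 \<le> bonsall_radius C T"
proof -
  obtain r where r: "(\<lambda>n. root n (cone_norm C (T ^^ n))) \<longlonglongrightarrow> r"
    "\<And>m. 0 < m \<Longrightarrow> r \<le> root m (cone_norm C (T ^^ m))" "0 \<le> r"
    using submultiplicative_root_tendsto[OF cone_norm_nonneg cone_norm_submult] by blast
  have "bonsall_radius C T = r"
    unfolding bonsall_radius_def using r(1) by (rule limI)
  then show "(\<lambda>n. root n (cone_norm C (T ^^ n))) \<longlonglongrightarrow> bonsall_radius C T"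
    and "0 < m \<Longrightarrow> bonsall_radius C T \<le> root m (cone_norm C (T ^^ m))"
    and "0 \<le> bonsall_radius C T"
    using r by auto
qed

lemma local_radius_le_bonsall_radius:
  assumes "x \<in> C"
  shows "local_radius T x \<le> ereal (bonsall_radius C T)"
proof -
  \<comment> \<open>The factor \<open>norm x + 1\<close> instead of \<open>norm x\<close> has roots tending to 1 also when \<open>x = 0\<close>.\<close>
  let ?b = "\<lambda>n. root n (cone_norm C (T ^^ n)) * root n (norm x + 1)"
  have "?b \<longlonglongrightarrow> bonsall_radius C T * 1"
    by (intro tendsto_mult bonsall_radius_tendsto LIMSEQ_root_const) (simp add: add_nonneg_pos)
  then have "limsup (\<lambda>n. ereal (?b n)) = ereal (bonsall_radius C T)"
    by (intro lim_imp_Limsup) auto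
  moreover have "local_radius T x \<le> limsup (\<lambda>n. ereal (?b n))"
    unfolding local_radius_def
  proof (rule Limsup_mono)
    show "\<forall>\<^sub>F n in sequentially. ereal (root n (norm ((T ^^ n) x))) \<le> ereal (?b n)"
      using eventually_gt_at_top[of 0]
    proof eventually_elim
      case (elim n)
      have "norm ((T ^^ n) x) \<le> cone_norm C (T ^^ n) * (norm x + 1)"
        by (rule order_trans[OF norm_iterate_le[OF assms]])
           (intro mult_left_mono cone_norm_nonneg, simp)
      then have "root n (norm ((T ^^ n) x)) \<le> root n (cone_norm C (T ^^ n) * (norm x + 1))"
        using elim by simp
      then show ?case by (simp add: real_root_mult)
    qed
  qed
  ultimately show ?thesis by simp
qed

lemma scaled_iterates_tendsto_0:
  assumes "x \<in> C" "local_radius T x \<le> ereal t" "0 \<le> t" "t < s"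
  shows "(\<lambda>n. (1 / s ^ n) *\<^sub>R (T ^^ n) x) \<longlonglongrightarrow> 0"
proof -
  obtain c where c: "t < c" "c < s"
    using \<open>t < s\<close> dense by blast
  have "local_radius T x < ereal c"
    using assms(2) c(1) by (simp add: le_less_trans)
  then have "\<forall>\<^sub>F n in sequentially. ereal (root n (norm ((T ^^ n) x))) < ereal c"
    unfolding local_radius_def by (rule Limsup_lessD)
  then have bound: "\<forall>\<^sub>F n in sequentially. norm ((1 / s ^ n) *\<^sub>R (T ^^ n) x) \<le> (c / s) ^ n"
    using eventually_gt_at_top[of 0]
  proof eventually_elim
    case (elim n)
    have "root n (norm ((T ^^ n) x)) ^ n \<le> c ^ n"
      by (rule power_mono) (use elim in auto)
    then have "norm ((T ^^ n) x) \<le> c ^ n"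
      using elim by simp
    then show ?case
      using c assms by (simp add: power_divide divide_right_mono)
  qed
  have "(\<lambda>n. (c / s) ^ n) \<longlonglongrightarrow> 0"
    by (rule LIMSEQ_realpow_zero) (use c assms in auto)
  with bound show ?thesis
    by (rule Lim_null_comparison)
qed

text \<open>Unless \<open>t\<close> is in the spectrum, some power of \<open>T\<close> is at most half of \<open>t ^ n\<close> in norm, which
  pushes the spectral radius strictly below \<open>t\<close>.\<close>

lemma in_spectrum_if_between_radii:
  assumes "normal_wedge C" and locals: "\<And>x. x \<in> C \<Longrightarrow> local_radius T x \<le> ereal t"
    and t: "t \<le> bonsall_radius C T"
  shows "t \<in> approx_point_spectrum C T"
proof (rule ccontr)
  assume not_in: "t \<notin> approx_point_spectrum C T"
  have "0 \<le> t"
  proof -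
    have "(T ^^ n) 0 = 0" for n
      using iterate_hom[of 0 x\<^sub>0 n] nontrivial by simp
    then have "local_radius T 0 = 0"
      by (simp add: local_radius_def zero_ereal_def[symmetric] Limsup_const)
    then show ?thesis
      using locals[OF convex_cone_contains_0[OF wedge]] by simp
  qed
  obtain \<delta> where \<delta>: "0 < \<delta>" "\<And>x. x \<in> C \<Longrightarrow> \<delta> * norm x \<le> norm (T x - t *\<^sub>R x)"
    using bounded_below_if_not_in_spectrum[OF nontrivial \<open>0 \<le> t\<close> not_in] by blast
  obtain M' where M': "\<And>x y. x \<in> C \<Longrightarrow> y \<in> C \<Longrightarrow> y - x \<in> C \<Longrightarrow> norm x \<le> M' * norm y"
    using \<open>normal_wedge C\<close> unfolding normal_wedge_def wedge_le_def by blast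
  define M where "M = max 0 M'"
  have "norm x \<le> M * norm y" if "x \<in> C" "y \<in> C" "y - x \<in> C" for x y
    by (rule order_trans[OF M'[OF that]]) (simp add: M_def mult_right_mono)
  moreover have "0 \<le> M"
    by (simp add: M_def)
  ultimately obtain n where n: "0 < n" "0 < t"
    "\<And>x. x \<in> C \<Longrightarrow> norm ((T ^^ n) x) \<le> (1 / 2) * t ^ n * norm x"
    using decay_if_bounded_below[OF _ _ \<delta> \<open>0 \<le> t\<close> _ nontrivial]
      scaled_iterates_tendsto_0[OF _ locals \<open>0 \<le> t\<close>] by blast
  have "bonsall_radius C T \<le> root n (cone_norm C (T ^^ n))"
    by (rule bonsall_radius_le_root[OF n(1)])
  also have "\<dots> \<le> root n ((1 / 2) * t ^ n)"
    using n(1) cone_norm_le[OF n(3) nontrivial] by simp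
  also have "\<dots> < root n (t ^ n)"
    using n by (intro real_root_less_mono) auto
  also have "\<dots> = t"
    using n by (simp add: real_root_power_cancel)
  finally show False
    using t by simp
qed

text \<open>Since \<open>T\<close> is Lipschitz, iterating it multiplies the error of an approximate eigenvector by
  a constant depending only on \<open>n\<close>. Approximate eigenvectors for \<open>t\<close> thus show
  \<open>t ^ n \<le> cone_norm C (T ^^ n)\<close>.\<close>

lemma spectrum_le_bonsall_radius:
  assumes "t \<in> approx_point_spectrum C T"
  shows "t \<le> bonsall_radius C T"
proof -
  have "0 \<le> t" and approx: "\<And>\<epsilon>. 0 < \<epsilon> \<Longrightarrow> \<exists>x\<in>C. norm x = 1 \<and> norm (T x - t *\<^sub>R x) < \<epsilon>"
    using assms approx_point_spectrum_iff[OF nontrivial wedge, of t T] by auto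
  have "\<exists>B\<ge>0. \<forall>x\<in>C. norm ((T ^^ n) x - t ^ n *\<^sub>R x) \<le> B * norm (T x - t *\<^sub>R x)" for n
  proof (induction n)
    case 0
    show ?case by (rule exI[of _ 0]) simp
  next
    case (Suc n)
    then obtain B where B: "0 \<le> B"
      "\<And>x. x \<in> C \<Longrightarrow> norm ((T ^^ n) x - t ^ n *\<^sub>R x) \<le> B * norm (T x - t *\<^sub>R x)"
      by blast
    have "norm ((T ^^ Suc n) x - t ^ Suc n *\<^sub>R x) \<le> (L * B + t ^ n) * norm (T x - t *\<^sub>R x)"
      if x: "x \<in> C" for x
    proof -
      have tx: "t ^ n *\<^sub>R x \<in> C"
        using \<open>0 \<le> t\<close> by (intro convex_cone_scaleR[OF wedge] x) auto
      have "(T ^^ Suc n) x - t ^ Suc n *\<^sub>R x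
          = (T ((T ^^ n) x) - T (t ^ n *\<^sub>R x)) + t ^ n *\<^sub>R (T x - t *\<^sub>R x)"
        using hom[of "t ^ n" x] x \<open>0 \<le> t\<close> by (simp add: algebra_simps)
      also have "norm \<dots> \<le> norm (T ((T ^^ n) x) - T (t ^ n *\<^sub>R x))
          + norm (t ^ n *\<^sub>R (T x - t *\<^sub>R x))"
        by (rule norm_triangle_ineq)
      also have "\<dots> \<le> L * (B * norm (T x - t *\<^sub>R x)) + t ^ n * norm (T x - t *\<^sub>R x)"
        using norm_diff_le[OF iterate_maps[OF x] tx]
          mult_left_mono[OF B(2)[OF x] L_nonneg] \<open>0 \<le> t\<close>
        by (intro add_mono) (auto intro: order_trans)
      finally show ?thesis by (simp add: algebra_simps)
    qed
    then show ?case
      using B L_nonneg \<open>0 \<le> t\<close> by (intro exI[of _ "L * B + t ^ n"]) auto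
  qed
  then obtain B where B: "\<And>n. 0 \<le> B n"
    "\<And>n x. x \<in> C \<Longrightarrow> norm ((T ^^ n) x - t ^ n *\<^sub>R x) \<le> B n * norm (T x - t *\<^sub>R x)"
    by metis
  have power_le: "t ^ n \<le> cone_norm C (T ^^ n)" for n
  proof (rule field_le_epsilon)
    fix e :: real assume "0 < e"
    then have "0 < e / (B n + 1)"
      using B(1)[of n] by (intro divide_pos_pos) auto
    then obtain x where x: "x \<in> C" "norm x = 1" "norm (T x - t *\<^sub>R x) < e / (B n + 1)"
      using approx by blast
    have "t ^ n = norm (t ^ n *\<^sub>R x)"
      using x \<open>0 \<le> t\<close> by simp
    also have "\<dots> \<le> norm ((T ^^ n) x) + norm ((T ^^ n) x - t ^ n *\<^sub>R x)"
      by (metis norm_triangle_sub norm_minus_commute)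
    also have "\<dots> \<le> cone_norm C (T ^^ n) + B n * (e / (B n + 1))"
      using norm_iterate_le[OF x(1), of n] B(2)[OF x(1), of n] x
        mult_left_mono[OF less_imp_le[OF x(3)] B(1)[of n]] by simp
    also have "B n * (e / (B n + 1)) \<le> e"
      using B(1)[of n] \<open>0 < e\<close> by (simp add: field_simps)
    finally show "t ^ n \<le> cone_norm C (T ^^ n) + e" by simp
  qed
  show ?thesis
  proof (rule tendsto_lowerbound[OF bonsall_radius_tendsto])
    show "\<forall>\<^sub>F n in sequentially. t \<le> root n (cone_norm C (T ^^ n))"
      using eventually_gt_at_top[of 0]
    proof eventually_elim
      case (elim n)
      have "t = root n (t ^ n)"
        using elim \<open>0 \<le> t\<close> by (simp add: real_root_power_cancel)
      also have "\<dots> \<le> root n (cone_norm C (T ^^ n))"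
        using elim power_le by simp
      finally show ?case .
    qed
  qed simp
qed

end

theorem theorem4p1:
  fixes C :: "'a::real_normed_vector set" and T :: "'a \<Rightarrow> 'a"
  assumes "convex_cone C" and "C \<noteq> {0}" and "normal_wedge C"
    and "T ` C \<subseteq> C"
    and "positively_homogeneous_on C T"
    and "additive_on C T"
    and "\<exists>L>0. L-lipschitz_on C T"
  shows "(\<forall>t::real. (SUP x\<in>C. local_radius T x) \<le> ereal t \<and> t \<le> bonsall_radius C T
             \<longrightarrow> t \<in> approx_point_spectrum C T)
       \<and> bonsall_radius C T \<in> approx_point_spectrum C T
       \<and> (bonsall_radius C T \<in> approx_point_spectrum C T
            \<and> (\<forall>t\<in>approx_point_spectrum C T. t \<le> bonsall_radius C T))"
proof -
  obtain L where L: "L-lipschitz_on C T"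
    using assms(7) by blast
  obtain x\<^sub>0 where x\<^sub>0: "x\<^sub>0 \<in> C" "x\<^sub>0 \<noteq> 0"
    using convex_cone_contains_0[OF assms(1)] assms(2) by blast
  interpret lipschitz_wedge_map C T L x\<^sub>0
    using assms(1,4,5,6) L x\<^sub>0
    by unfold_locales (auto simp: positively_homogeneous_on_def additive_on_def)
  have "t \<in> approx_point_spectrum C T"
    if "(SUP x\<in>C. local_radius T x) \<le> ereal t" "t \<le> bonsall_radius C T" for t
    using in_spectrum_if_between_radii[OF assms(3) _ that(2)] that(1) by (simp add: SUP_le_iff)
  moreover have "bonsall_radius C T \<in> approx_point_spectrum C T"
    by (rule in_spectrum_if_between_radii[OF assms(3) local_radius_le_bonsall_radius]) simp_all
  ultimately show ?thesis
    using spectrum_le_bonsall_radius by blast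
qed

end
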